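(* Let $X$ and $Y$ be positive Markov processes and let $\star_2\in\{\infty\cdot 0^+,\infty^-\cdot 0\}$. If $X$ is in $(0^+\cdot\infty,\star_2)$-Laplace duality with $Y$, then $0$ is absorbing for $X$ if and only if $\infty$ is non-sticky for $Y$. If $X$ is in $(0\cdot\infty^-,\star_2)$-Laplace duality with $Y$, then $\infty$ is absorbing for $Y$ if and only if $0$ is non-sticky for $X$.
   Context: Positive Markov process: a time-homogeneous Markov process with values in $[0,\infty]$ (Borel $\sigma$-field), under probabilities $(\mathbb{P}_x)_{x\in[0,\infty]}$ on a common measurable space, with $x\mapsto\mathbb{P}_x(X_t\in A)$ Borel, $\mathbb{P}_x(X_0=x)=1$ and the Markov property; no path regularity is assumed. $p_t(x,\cdot)$ is the law of $X_t$ under $\mathbb{P}_x$. For $Y$ the laws and expectations are written $\mathbb{P}^y,\mathbb{E}^y$. Conventions: $e^{-\infty}=0$, and $x\cdot\infty=\infty\cdot x=\infty$ for $x\in(0,\infty]$. Under $0^+\cdot\infty$ one interprets $e^{-0\cdot\infty}=0$; under $0\cdot\infty^-$, $e^{-0\cdot\infty}=1$; under $\infty\cdot 0^+$, $e^{-\infty\cdot 0}=0$; under $\infty^-\cdot 0$, $e^{-\infty\cdot 0}=1$. In products the first factor refers to the $X$-variable and the second to the $Y$-variable. $X$ is in $(\star_1,\star_2)$-Laplace duality with $Y$ if $\mathbb{E}_x[e^{-X_ty}]=\mathbb{E}^y[e^{-xY_t}]$ for all $t\in[0,\infty)$, $(x,y)\in[0,\infty]^2$, under these conventions. A boundary point $x\in\{0,\infty\}$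 is absorbing for $X$ if $p_t(x,\cdot)=\delta_x$ for all $t\in[0,\infty)$; it is non-sticky for $X$ if $p_t(u,[0,\infty]\setminus\{x\})=1$ for all $u\in[0,\infty]\setminus\{x\}$ and all $t\in[0,\infty)$. Analogously for $Y$. *)

theory Defs
  imports "HOL-Probability.Probability"
begin

text \<open>The state space \<open>[0,\<infinity>]\<close> with its Borel \<open>\<sigma>\<close>-field is \<^typ>\<open>ennreal\<close> with \<^term>\<open>borel :: ennreal measure\<close>.
  Time is \<^typ>\<open>real\<close>, and the values of a process at negative times are never referred to.\<close>

definition natural_filtration :: "'a measure \<Rightarrow> (real \<Rightarrow> 'a \<Rightarrow> ennreal) \<Rightarrow> real \<Rightarrow> 'a measure" where
  "natural_filtration M X t =
     sigma (space M) (\<Union>s\<in>{0..t}. {X s -` A \<inter> space M | A. A \<in> sets borel})"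

definition transition :: "(ennreal \<Rightarrow> 'a measure) \<Rightarrow> (real \<Rightarrow> 'a \<Rightarrow> ennreal) \<Rightarrow> real \<Rightarrow> ennreal \<Rightarrow> ennreal measure" where
  "transition P X t x = distr (P x) borel (X t)"

text \<open>\<open>M\<close> serves only as the common measurable space; its measure plays no role.
  The Markov property is taken with respect to the natural filtration.\<close>

locale positive_markov_process =
  fixes M :: "'a measure" and P :: "ennreal \<Rightarrow> 'a measure" and X :: "real \<Rightarrow> 'a \<Rightarrow> ennreal"
  assumes prob_space_P: "\<And>x. prob_space (P x)"
    and sets_P: "\<And>x. sets (P x) = sets M"
    and measurable_X: "\<And>t. 0 \<le> t \<Longrightarrow> X t \<in> borel_measurable M"
    and measurable_transition: "\<And>t A. 0 \<le> t \<Longrightarrow> A \<in> sets borel \<Longrightarrow>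
          (\<lambda>x. measure (transition P X t x) A) \<in> borel_measurable borel"
    and start: "\<And>x. AE \<omega> in P x. X 0 \<omega> = x"
    and markov: "\<And>x s t A. 0 \<le> s \<Longrightarrow> 0 \<le> t \<Longrightarrow> A \<in> sets borel \<Longrightarrow>
          AE \<omega> in P x. real_cond_exp (P x) (natural_filtration M X s) (\<lambda>\<omega>'. indicator A (X (s + t) \<omega>')) \<omega>
                        = measure (transition P X t (X s \<omega>)) A"
begin

text \<open>\<^const>\<open>real_cond_exp\<close> is meaningful only relative to a subalgebra.\<close>

lemma subalgebra_natural_filtration: "subalgebra (P x) (natural_filtration M X t)"
proof -
  have sp: "space (P x) = space M"
    using sets_P by (rule sets_eq_imp_space_eq)
  have gen: "(\<Union>s\<in>{0..t}. {X s -` A \<inter> space M | A. A \<in> sets borel}) \<subseteq> sets M"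
    using measurable_X by (auto intro: measurable_sets)
  then have "(\<Union>s\<in>{0..t}. {X s -` A \<inter> space M | A. A \<in> sets borel}) \<subseteq> Pow (space M)"
    using sets.sets_into_space by blast
  with gen sp show ?thesis
    unfolding subalgebra_def natural_filtration_def
    by (simp add: sets_P space_measure_of_conv sets.sigma_sets_subset)
qed

end

datatype zero_infty_convention =
    Zero_plus_times_Infty   \<comment> \<open>\<open>0\<^sup>+ \<cdot> \<infinity>\<close>: \<open>exp (- 0 \<cdot> \<infinity>) = 0\<close>\<close>
  | Zero_times_Infty_minus  \<comment> \<open>\<open>0 \<cdot> \<infinity>\<^sup>-\<close>: \<open>exp (- 0 \<cdot> \<infinity>) = 1\<close>\<close>

datatype infty_zero_convention =
    Infty_times_Zero_plus   \<comment> \<open>\<open>\<infinity> \<cdot> 0\<^sup>+\<close>: \<open>exp (- \<infinity> \<cdot> 0) = 0\<close>\<close>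
  | Infty_minus_times_Zero  \<comment> \<open>\<open>\<infinity>\<^sup>- \<cdot> 0\<close>: \<open>exp (- \<infinity> \<cdot> 0) = 1\<close>\<close>

text \<open>\<open>exp (- x y)\<close> with \<open>x\<close> the \<open>X\<close>-variable and \<open>y\<close> the \<open>Y\<close>-variable. The two ambiguous products
  are handled first, since \<^typ>\<open>ennreal\<close> sets \<open>0 \<cdot> \<infinity> = 0\<close>; all other products follow the usual rule.\<close>

definition laplace_kernel ::
    "zero_infty_convention \<Rightarrow> infty_zero_convention \<Rightarrow> ennreal \<Rightarrow> ennreal \<Rightarrow> real" where
  "laplace_kernel s1 s2 x y =
     (if x = 0 \<and> y = \<infinity> then (case s1 of Zero_plus_times_Infty \<Rightarrow> 0 | Zero_times_Infty_minus \<Rightarrow> 1)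
      else if x = \<infinity> \<and> y = 0 then (case s2 of Infty_times_Zero_plus \<Rightarrow> 0 | Infty_minus_times_Zero \<Rightarrow> 1)
      else if x * y = \<infinity> then 0
      else exp (- enn2real (x * y)))"

definition laplace_dual ::
    "zero_infty_convention \<Rightarrow> infty_zero_convention \<Rightarrow>
     (ennreal \<Rightarrow> 'a measure) \<Rightarrow> (real \<Rightarrow> 'a \<Rightarrow> ennreal) \<Rightarrow>
     (ennreal \<Rightarrow> 'b measure) \<Rightarrow> (real \<Rightarrow> 'b \<Rightarrow> ennreal) \<Rightarrow> bool" where
  "laplace_dual s1 s2 P X Q Y \<longleftrightarrow>
     (\<forall>t\<ge>0. \<forall>x y. (\<integral>\<omega>. laplace_kernel s1 s2 (X t \<omega>) y \<partial>P x)
                = (\<integral>\<omega>. laplace_kernel s1 s2 x (Y t \<omega>) \<partial>Q y))"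

text \<open>The next two notions are used only at the boundary points \<open>0\<close> and \<open>\<infinity>\<close>.\<close>

definition absorbing :: "(ennreal \<Rightarrow> 'a measure) \<Rightarrow> (real \<Rightarrow> 'a \<Rightarrow> ennreal) \<Rightarrow> ennreal \<Rightarrow> bool" where
  "absorbing P X x \<longleftrightarrow> (\<forall>t\<ge>0. transition P X t x = return borel x)"

definition non_sticky :: "(ennreal \<Rightarrow> 'a measure) \<Rightarrow> (real \<Rightarrow> 'a \<Rightarrow> ennreal) \<Rightarrow> ennreal \<Rightarrow> bool" where
  "non_sticky P X x \<longleftrightarrow> (\<forall>u. u \<noteq> x \<longrightarrow> (\<forall>t\<ge>0. measure (transition P X t u) (UNIV - {x}) = 1))"

end

theory Submission
  imports Defs
begin

text \<open>At the boundary the Laplace kernel degenerates to an indicator. Under \<open>0\<^sup>+ \<cdot> \<infinity>\<close> it satisfies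
  \<open>exp (- 0 y) = 1\<close> for \<open>y \<noteq> \<infinity>\<close> and \<open>exp (- 0 y) = 0\<close> for \<open>y = \<infinity>\<close>, so that duality at \<open>x = 0\<close> reads
  \<open>E\<^sub>0[exp (- X\<^sub>t y)] = P\<^sup>y(Y\<^sub>t \<noteq> \<infinity>)\<close>. If \<open>0\<close> is absorbing for \<open>X\<close>, the left-hand side is \<open>1\<close> for
  every \<open>y \<noteq> \<infinity>\<close>, which is non-stickiness of \<open>\<infinity>\<close>. Conversely, non-stickiness at the single point
  \<open>y = 1\<close> gives \<open>E\<^sub>0[exp (- X\<^sub>t)] = 1\<close>, and a variable \<open>exp (- X\<^sub>t) \<le> 1\<close> with mean \<open>1\<close> is almost surely
  \<open>1\<close>, whence \<open>X\<^sub>t = 0\<close> almost surely. Under \<open>0 \<cdot> \<infinity>\<^sup>-\<close> the argument is the mirror image: duality at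
  \<open>y = \<infinity>\<close> reads \<open>P\<^sub>x(X\<^sub>t = 0) = E\<^sup>\<infinity>[exp (- x Y\<^sub>t)]\<close>, and at \<open>x = 1\<close> a non-negative variable
  \<open>exp (- Y\<^sub>t)\<close> with mean \<open>0\<close> vanishes almost surely, whence \<open>Y\<^sub>t = \<infinity>\<close> almost surely.

  The convention for \<open>\<infinity> \<cdot> 0\<close> plays no role: the kernel is only ever evaluated almost surely at
  pairs with \<open>x = 0\<close>, \<open>y = \<infinity>\<close>, \<open>x = 1\<close> or \<open>y = 1\<close>, none of which is \<open>(\<infinity>, 0)\<close>.\<close>

lemma laplace_kernel_zero_plus:
  "laplace_kernel Zero_plus_times_Infty s2 0 y = indicator (- {\<infinity>}) y"
  by (auto simp: laplace_kernel_def)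

lemma laplace_kernel_infty_minus:
  "laplace_kernel Zero_times_Infty_minus s2 x \<infinity> = indicator {0} x"
  by (auto simp: laplace_kernel_def ennreal_mult_top top_neq_ennreal)

lemma laplace_kernel_one_right:
  "laplace_kernel s1 s2 x 1 = (if x = \<infinity> then 0 else exp (- enn2real x))"
  by (auto simp: laplace_kernel_def)

lemma laplace_kernel_one_left:
  "laplace_kernel s1 s2 1 y = (if y = \<infinity> then 0 else exp (- enn2real y))"
  by (auto simp: laplace_kernel_def)

lemma measurable_laplace_kernel_left [measurable]:
  "(\<lambda>x. laplace_kernel s1 s2 x y) \<in> borel_measurable borel"
  unfolding laplace_kernel_def by measurable

lemma measurable_laplace_kernel_right [measurable]:
  "laplace_kernel s1 s2 x \<in> borel_measurable borel"
  unfolding laplace_kernel_def by measurable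

lemma laplace_kernel_nonneg: "0 \<le> laplace_kernel s1 s2 x y"
  by (auto simp: laplace_kernel_def split: zero_infty_convention.split infty_zero_convention.split)

lemma laplace_kernel_le_1: "laplace_kernel s1 s2 x y \<le> 1"
  by (auto simp: laplace_kernel_def split: zero_infty_convention.split infty_zero_convention.split)

lemma (in prob_space) expectation_eq_1_imp_AE:
  fixes f :: "'a \<Rightarrow> real"
  assumes f: "f \<in> borel_measurable M" and bounds: "\<And>\<omega>. 0 \<le> f \<omega>" "\<And>\<omega>. f \<omega> \<le> 1"
    and mean: "expectation f = 1"
  shows "AE \<omega> in M. f \<omega> = 1"
proof -
  have int: "integrable M f"
    using f bounds by (intro integrable_const_bound[where B = 1]) auto
  then have "expectation (\<lambda>\<omega>. 1 - f \<omega>) = 0"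
    using mean by (simp add: prob_space)
  with int have "AE \<omega> in M. 1 - f \<omega> = 0"
    using bounds by (subst (asm) integral_nonneg_eq_0_iff_AE) auto
  then show ?thesis
    by auto
qed

context positive_markov_process
begin

lemma measurable_X_P [measurable]: "0 \<le> t \<Longrightarrow> X t \<in> borel_measurable (P x)"
  using measurable_X by (simp add: measurable_cong_sets[OF sets_P refl])

lemma absorbing_iff_AE:
  "absorbing P X x \<longleftrightarrow> (\<forall>t\<ge>0. AE \<omega> in P x. X t \<omega> = x)"
proof -
  interpret prob_space "P x" by (rule prob_space_P)
  have "distr (P x) borel (X t) = return borel x \<longleftrightarrow> (AE \<omega> in P x. X t \<omega> = x)" if t: "0 \<le> t" for t
  proof
    assume law: "distr (P x) borel (X t) = return borel x"
    have "AE z in return borel x. z = x"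
      by (simp add: AE_return)
    then have "AE z in distr (P x) borel (X t). z = x"
      by (simp only: law)
    then show "AE \<omega> in P x. X t \<omega> = x"
      by (rule AE_distrD[OF measurable_X_P[OF t]])
  next
    assume "AE \<omega> in P x. X t \<omega> = x"
    then have "distr (P x) borel (X t) = distr (P x) borel (\<lambda>_. x)"
      using t by (intro distr_cong_AE) auto
    then show "distr (P x) borel (X t) = return borel x"
      by (simp add: distr_const)
  qed
  then show ?thesis
    by (simp add: absorbing_def transition_def)
qed

lemma expectation_indicator_X:
  assumes "0 \<le> t" "A \<in> sets borel"
  shows "(\<integral>\<omega>. indicator A (X t \<omega>) \<partial>P u) = measure (transition P X t u) A"
proof -
  have "(\<integral>\<omega>. indicator A (X t \<omega>) \<partial>P u) = (\<integral>z. indicator A z \<partial>transition P X t u :: real)"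
    unfolding transition_def using assms by (intro integral_distr[symmetric]) auto
  also have "\<dots> = measure (transition P X t u) A"
    by (simp add: transition_def)
  finally show ?thesis .
qed

lemma non_sticky_iff_null:
  "non_sticky P X x \<longleftrightarrow> (\<forall>u. u \<noteq> x \<longrightarrow> (\<forall>t\<ge>0. measure (transition P X t u) {x} = 0))"
proof -
  have "measure (transition P X t u) (UNIV - {x}) = 1 - measure (transition P X t u) {x}"
    if "0 \<le> t" for t u
  proof -
    interpret prob_space "transition P X t u"
      unfolding transition_def
      using prob_space_P measurable_X_P[OF that] by (rule prob_space.prob_space_distr)
    show ?thesis
      using prob_compl[of "{x}"] by (simp add: transition_def)
  qed
  then show ?thesis
    by (auto simp: non_sticky_def)
qed

end

theorem corollary3p14:
  fixes M :: "'a measure" and P :: "ennreal \<Rightarrow> 'a measure" and X :: "real \<Rightarrow> 'a \<Rightarrow> ennreal"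
    and N :: "'b measure" and Q :: "ennreal \<Rightarrow> 'b measure" and Y :: "real \<Rightarrow> 'b \<Rightarrow> ennreal"
    and s2 :: infty_zero_convention
  assumes "positive_markov_process M P X"
    and "positive_markov_process N Q Y"
  shows "(laplace_dual Zero_plus_times_Infty s2 P X Q Y \<longrightarrow>
            (absorbing P X 0 \<longleftrightarrow> non_sticky Q Y \<infinity>)) \<and>
         (laplace_dual Zero_times_Infty_minus s2 P X Q Y \<longrightarrow>
            (absorbing Q Y \<infinity> \<longleftrightarrow> non_sticky P X 0))"
proof -
  interpret X: positive_markov_process M P X by fact
  interpret Y: positive_markov_process N Q Y by fact
  have part1: "absorbing P X 0 \<longleftrightarrow> non_sticky Q Y \<infinity>"
    if dual: "laplace_dual Zero_plus_times_Infty s2 P X Q Y"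
  proof -
    let ?k = "laplace_kernel Zero_plus_times_Infty s2"
    interpret P0: prob_space "P 0" by (rule X.prob_space_P)
    have key: "(\<integral>\<omega>. ?k (X t \<omega>) y \<partial>P 0) = measure (transition Q Y t y) (UNIV - {\<infinity>})"
      if t: "0 \<le> t" for t y
    proof -
      have "(\<integral>\<omega>. ?k (X t \<omega>) y \<partial>P 0) = (\<integral>\<omega>. ?k 0 (Y t \<omega>) \<partial>Q y)"
        using dual t by (simp add: laplace_dual_def)
      also have "\<dots> = measure (transition Q Y t y) (- {\<infinity>})"
        using t by (simp only: laplace_kernel_zero_plus) (rule Y.expectation_indicator_X, auto)
      finally show ?thesis
        by (simp add: Compl_eq_Diff_UNIV)
    qed
    show ?thesis
    proof
      assume "absorbing P X 0"
      then have AE: "AE \<omega> in P 0. X t \<omega> = 0" if "0 \<le> t" for t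
        using that by (simp add: X.absorbing_iff_AE)
      have "measure (transition Q Y t y) (UNIV - {\<infinity>}) = 1" if y: "y \<noteq> \<infinity>" and t: "0 \<le> t" for t y
      proof -
        have "AE \<omega> in P 0. ?k (X t \<omega>) y = 1"
          using AE[OF t] by eventually_elim (use y in \<open>simp add: laplace_kernel_zero_plus\<close>)
        then have "(\<integral>\<omega>. ?k (X t \<omega>) y \<partial>P 0) = (\<integral>\<omega>. 1 \<partial>P 0)"
          using t by (intro integral_cong_AE) auto
        then show ?thesis
          using key[OF t] by (simp add: P0.prob_space)
      qed
      then show "non_sticky Q Y \<infinity>"
        by (simp add: non_sticky_def)
    next
      assume ns: "non_sticky Q Y \<infinity>"
      have "AE \<omega> in P 0. X t \<omega> = 0" if t: "0 \<le> t" for t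
      proof -
        have "(\<integral>\<omega>. ?k (X t \<omega>) 1 \<partial>P 0) = 1"
          using ns t by (simp add: key non_sticky_def)
        then have "AE \<omega> in P 0. ?k (X t \<omega>) 1 = 1"
          using t by (intro P0.expectation_eq_1_imp_AE) (auto simp: laplace_kernel_nonneg laplace_kernel_le_1)
        then show ?thesis
          by eventually_elim
            (auto simp: laplace_kernel_one_right enn2real_eq_0_iff split: if_splits)
      qed
      then show "absorbing P X 0"
        by (simp add: X.absorbing_iff_AE)
    qed
  qed
  have part2: "absorbing Q Y \<infinity> \<longleftrightarrow> non_sticky P X 0"
    if dual: "laplace_dual Zero_times_Infty_minus s2 P X Q Y"
  proof -
    let ?k = "laplace_kernel Zero_times_Infty_minus s2"
    interpret Qi: prob_space "Q \<infinity>" by (rule Y.prob_space_P)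
    have key: "measure (transition P X t x) {0} = (\<integral>\<omega>. ?k x (Y t \<omega>) \<partial>Q \<infinity>)"
      if t: "0 \<le> t" for t x
    proof -
      have "measure (transition P X t x) {0} = (\<integral>\<omega>. ?k (X t \<omega>) \<infinity> \<partial>P x)"
        using t by (simp only: laplace_kernel_infty_minus)
          (rule X.expectation_indicator_X[symmetric], auto)
      also have "\<dots> = (\<integral>\<omega>. ?k x (Y t \<omega>) \<partial>Q \<infinity>)"
        using dual t by (simp add: laplace_dual_def)
      finally show ?thesis .
    qed
    show ?thesis
    proof
      assume "absorbing Q Y \<infinity>"
      then have AE: "AE \<omega> in Q \<infinity>. Y t \<omega> = \<infinity>" if "0 \<le> t" for t
        using that unfolding Y.absorbing_iff_AE by blast
      have "measure (transition P X t x) {0} = 0" if x: "x \<noteq> 0" and t: "0 \<le> t" for t x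
      proof -
        have "AE \<omega> in Q \<infinity>. ?k x (Y t \<omega>) = 0"
          using AE[OF t]
        proof eventually_elim
          case (elim \<omega>)
          then show ?case
            using x laplace_kernel_infty_minus[of s2 x] by simp
        qed
        then show ?thesis
          unfolding key[OF t] by (rule integral_eq_zero_AE)
      qed
      then show "non_sticky P X 0"
        by (simp add: X.non_sticky_iff_null)
    next
      assume ns: "non_sticky P X 0"
      have "AE \<omega> in Q \<infinity>. Y t \<omega> = \<infinity>" if t: "0 \<le> t" for t
      proof -
        have "measure (transition P X t 1) {0} = 0"
          using ns t by (simp add: X.non_sticky_iff_null)
        then have "(\<integral>\<omega>. ?k 1 (Y t \<omega>) \<partial>Q \<infinity>) = 0"
          by (simp only: key[OF t])
        moreover have "integrable (Q \<infinity>) (\<lambda>\<omega>. ?k 1 (Y t \<omega>))"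
          using t by (intro Qi.integrable_const_bound[where B = 1])
            (auto simp: laplace_kernel_nonneg laplace_kernel_le_1)
        ultimately have "AE \<omega> in Q \<infinity>. ?k 1 (Y t \<omega>) = 0"
          by (subst (asm) integral_nonneg_eq_0_iff_AE) (auto simp: laplace_kernel_nonneg)
        then show ?thesis
          by eventually_elim (auto simp: laplace_kernel_one_left split: if_splits)
      qed
      then show "absorbing Q Y \<infinity>"
        unfolding Y.absorbing_iff_AE by blast
    qed
  qed
  from part1 part2 show ?thesis
    by blast
qed

end
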